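(* Consider the function $$F(\boldsymbol x)=\min_{k\in[K]}\left\{{\boldsymbol\xi^0}^\top\boldsymbol a_k(\boldsymbol x)+b_k(\boldsymbol x)-\theta\|\boldsymbol a_k(\boldsymbol x)\|_{p^*}\right\},\qquad \boldsymbol x\in\mathcal X,$$ with domain $\mathcal X$. When $p=\infty$, $F$ is MICP-R. When $p\in(1,\infty)$, $F$ may not be MICP-R; that is, for every $p\in(1,\infty)$ there exist data $(n,m,K,\mathcal X,\boldsymbol\xi^0,\theta,\{\boldsymbol a_k\},\{b_k\})$ as in the context for which $F$ is not MICP-R.
   Context: $[K]=\{1,\dots,K\}$. $\mathcal X\subseteq\mathbb R^n$ is a compact convex set with non-empty relative interior. For $k\in[K]$, $\boldsymbol a_k(\boldsymbol x)=\hat{\boldsymbol A}_k\boldsymbol x+\hat{\boldsymbol a}_k\in\mathbb R^m$ and $b_k(\boldsymbol x)=\hat{\boldsymbol B}_k^\top\boldsymbol x+\hat b_k\in\mathbb R$ are affine. $\boldsymbol\xi^0\in\mathbb R^m$, $\theta\ge0$, $p\in[1,\infty]$ and $\|\cdot\|_{p^*}$ is the dual norm of $\|\cdot\|_p$ ($1/p+1/p^*=1$). $F$ is the objective function of the singular distributionally favorable optimization problem $\min_{\boldsymbol x\in\mathcal X}\min_{\|\boldsymbol\xi-\boldsymbol\xi^0\|_p\le\theta}\min_{k\in[K]}\{\boldsymbol\xi^\top\boldsymbol a_k(\boldsymbol x)+b_k(\boldsymbol x)\}$. MICP-R (mixed-integer convex programming representable): a set $S\subseteq\mathbb R^n$ is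 MICP-R if there are integers $r,d$ and a closed convex set $M\subseteq\mathbb R^{n+r+d}$ such that $\boldsymbol x\in S$ if and only if there exist $\boldsymbol y\in\mathbb R^r$, $\boldsymbol z\in\mathbb Z^d$ with $(\boldsymbol x,\boldsymbol y,\boldsymbol z)\in M$. A function $f:S\to\mathbb R$ is MICP-R if both its domain $S$ and its epigraph $\{(\boldsymbol x,t):\boldsymbol x\in S,\ f(\boldsymbol x)\le t\}$ are MICP-R. *)

theory Defs
  imports "HOL-Analysis.Analysis" "HOL-Library.Function_Algebras"
begin

text \<open>
  Dimensions are natural numbers: the space \<open>\<real>\<^sup>N\<close> is \<^const>\<open>Euclidean_space\<close> \<open>N\<close>, whose points are
  the functions \<open>nat \<Rightarrow> real\<close> that vanish from index \<open>N\<close> on (coordinates are numbered from 0).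
  The pointwise vector space structure makes \<^const>\<open>convex\<close> and \<^const>\<open>rel_interior\<close> available there.
\<close>

instantiation "fun" :: (type, real_vector) real_vector
begin

definition scaleR_fun :: "real \<Rightarrow> ('a \<Rightarrow> 'b) \<Rightarrow> 'a \<Rightarrow> 'b"
  where "scaleR_fun c f = (\<lambda>i. c *\<^sub>R f i)"

instance
  by standard (simp_all add: scaleR_fun_def fun_eq_iff scaleR_add_left scaleR_add_right)

end

abbreviation Rn :: "nat \<Rightarrow> (nat \<Rightarrow> real) set"
  where "Rn N \<equiv> topspace (Euclidean_space N)"

definition Zn :: "nat \<Rightarrow> (nat \<Rightarrow> real) set"
  where "Zn N = {z \<in> Rn N. \<forall>i<N. z i \<in> \<int>}"

text \<open>For \<open>u \<in> Rn N\<close> and \<open>v \<in> Rn N'\<close>, \<open>vjoin N u v\<close> is the stacked vector \<open>(u, v) \<in> Rn (N + N')\<close>.\<close>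

definition vjoin :: "nat \<Rightarrow> (nat \<Rightarrow> real) \<Rightarrow> (nat \<Rightarrow> real) \<Rightarrow> nat \<Rightarrow> real"
  where "vjoin N u v = (\<lambda>i. if i < N then u i else v (i - N))"

definition dot :: "nat \<Rightarrow> (nat \<Rightarrow> real) \<Rightarrow> (nat \<Rightarrow> real) \<Rightarrow> real"
  where "dot N u v = (\<Sum>i<N. u i * v i)"

subsection \<open>Mixed-integer convex representability\<close>

definition micpr_set :: "nat \<Rightarrow> (nat \<Rightarrow> real) set \<Rightarrow> bool"
  where "micpr_set n S \<longleftrightarrow> S \<subseteq> Rn n \<and>
    (\<exists>r d M. closedin (Euclidean_space (n + r + d)) M \<and> convex M \<and>
      (\<forall>x\<in>Rn n. x \<in> S \<longleftrightarrow> (\<exists>y\<in>Rn r. \<exists>z\<in>Zn d. vjoin n x (vjoin r y z) \<in> M)))"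

text \<open>For \<open>x \<in> Rn n\<close>, the vector \<open>(x, t) \<in> Rn (n + 1)\<close> is \<open>x(n := t)\<close>.\<close>

definition micpr_fun :: "nat \<Rightarrow> (nat \<Rightarrow> real) set \<Rightarrow> ((nat \<Rightarrow> real) \<Rightarrow> real) \<Rightarrow> bool"
  where "micpr_fun n S f \<longleftrightarrow>
    micpr_set n S \<and> micpr_set (n + 1) ((\<lambda>(x, t). x(n := t)) ` epigraph S f)"

subsection \<open>Norms with conjugate exponents\<close>

text \<open>The 0 inserted under \<^const>\<open>Max\<close> only matters in dimension 0.\<close>

definition lp_norm :: "nat \<Rightarrow> ennreal \<Rightarrow> (nat \<Rightarrow> real) \<Rightarrow> real"
  where "lp_norm N q v =
    (if q = \<infinity> then Max (insert 0 ((\<lambda>i. \<bar>v i\<bar>) ` {..<N}))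
     else (\<Sum>i<N. \<bar>v i\<bar> powr enn2real q) powr (1 / enn2real q))"

text \<open>In \<^typ>\<open>ennreal\<close>, \<open>inverse \<infinity> = 0\<close> and \<open>inverse 0 = \<infinity>\<close>, so the exponents 1 and \<open>\<infinity>\<close> are
  conjugate to each other.\<close>

definition conj_exponent :: "ennreal \<Rightarrow> ennreal"
  where "conj_exponent p = inverse (1 - inverse p)"

lemma conj_exponent_ennreal:
  assumes "1 < r"
  shows "conj_exponent (ennreal r) = ennreal (r / (r - 1))"
proof -
  have "1 - inverse (ennreal r) = ennreal (1 - inverse r)"
    using assms by (simp add: inverse_ennreal ennreal_minus flip: ennreal_1)
  moreover have "0 < 1 - inverse r"
    using assms by (simp add: field_simps)
  ultimately show ?thesis
    using assms by (simp add: conj_exponent_def inverse_ennreal field_simps)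
qed

lemma conj_exponent_sum:
  assumes "1 \<le> p"
  shows "inverse p + inverse (conj_exponent p) = 1"
proof (cases p)
  case (real r)
  then have "1 \<le> r"
    using assms by (simp flip: ennreal_1)
  show ?thesis
  proof (cases "r = 1")
    case True
    with real show ?thesis
      by (simp add: conj_exponent_def)
  next
    case False
    with \<open>1 \<le> r\<close> have "1 < r" by simp
    then show ?thesis
      using real by (simp add: conj_exponent_ennreal inverse_ennreal field_simps
          flip: ennreal_plus ennreal_1)
  qed
next
  case top
  then show ?thesis
    by (simp add: conj_exponent_def)
qed

subsection \<open>The objective function\<close>

definition affine_vec ::
    "nat \<Rightarrow> nat \<Rightarrow> (nat \<Rightarrow> nat \<Rightarrow> real) \<Rightarrow> (nat \<Rightarrow> real) \<Rightarrow> (nat \<Rightarrow> real) \<Rightarrow> nat \<Rightarrow> real"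
  where "affine_vec n m A a x = (\<lambda>i. if i < m then (\<Sum>j<n. A i j * x j) + a i else 0)"

definition dfo_objective ::
    "nat \<Rightarrow> nat \<Rightarrow> nat \<Rightarrow> ennreal \<Rightarrow> (nat \<Rightarrow> real) \<Rightarrow> real \<Rightarrow>
     (nat \<Rightarrow> nat \<Rightarrow> nat \<Rightarrow> real) \<Rightarrow> (nat \<Rightarrow> nat \<Rightarrow> real) \<Rightarrow>
     (nat \<Rightarrow> nat \<Rightarrow> real) \<Rightarrow> (nat \<Rightarrow> real) \<Rightarrow> (nat \<Rightarrow> real) \<Rightarrow> real"
  where "dfo_objective n m K p \<xi> \<theta> A a B b x =
    Min ((\<lambda>k. dot m \<xi> (affine_vec n m (A k) (a k) x) + (dot n (B k) x + b k)
              - \<theta> * lp_norm m (conj_exponent p) (affine_vec n m (A k) (a k) x)) ` {1..K})"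

definition dfo_data ::
    "nat \<Rightarrow> nat \<Rightarrow> nat \<Rightarrow> (nat \<Rightarrow> real) set \<Rightarrow> (nat \<Rightarrow> real) \<Rightarrow> real \<Rightarrow> bool"
  where "dfo_data n m K X \<xi> \<theta> \<longleftrightarrow>
    1 \<le> K \<and> compactin (Euclidean_space n) X \<and> convex X \<and> rel_interior X \<noteq> {} \<and>
    \<xi> \<in> Rn m \<and> 0 \<le> \<theta>"

end

theory Submission
  imports Defs
begin

text \<open>
  For \<open>p = \<infinity>\<close> the dual norm is the 1-norm, so \<open>F\<close> is a minimum of finitely many affine functions, one
  for each \<open>k\<close> and each choice of signs of the entries of \<open>a\<^sub>k(x)\<close>; on a compact domain such a minimum
  has a big-M formulation.

  For \<open>1 < p < \<infinity>\<close>, let \<open>q\<close> be the conjugate exponent and take \<open>F(x) = -\<parallel>(x, 1)\<parallel>\<^sub>q\<close> on \<open>[1, 2]\<close>, which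
  is strictly concave. Any infinite subset of a representable set contains two distinct points whose
  integer certificates agree modulo 2, so their midpoint belongs to the set as well. The graph of
  \<open>F\<close> is an infinite subset of the epigraph, but midpoints of its points lie strictly below it.
\<close>

section \<open>A necessary condition for representability: midpoints\<close>

lemma compactin_Euclidean_space_iff:
  "compactin (Euclidean_space N) M \<longleftrightarrow> compact M \<and> M \<subseteq> Rn N"
  by (auto simp: Euclidean_space_def compactin_subtopology euclidean_product_topology)

text \<open>There are at most \<open>2 ^ d\<close> parity patterns of integer certificates, so by
  the pigeonhole principle two points of \<open>R\<close> share one. Integer vectors of equal parity
  have an integer average, and convexity of \<open>M\<close> does the rest. Keeping \<open>R\<close>
  separate from \<open>S\<close> allows both points to be picked on a graph inside an
  epigraph.\<close>

lemma micpr_set_midpoint: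
  assumes S: "micpr_set n S" and R: "infinite R" "R \<subseteq> S"
  obtains u v where "u \<in> R" "v \<in> R" "u \<noteq> v" "(1/2) *\<^sub>R u + (1/2) *\<^sub>R v \<in> S"
proof -
  from S obtain r d M where sub: "S \<subseteq> Rn n" and M: "convex M"
    and rep: "\<And>x. x \<in> Rn n \<Longrightarrow>
      x \<in> S \<longleftrightarrow> (\<exists>y\<in>Rn r. \<exists>z\<in>Zn d. vjoin n x (vjoin r y z) \<in> M)"
    unfolding micpr_set_def by blast
  have "\<forall>x\<in>S. \<exists>y z. y \<in> Rn r \<and> z \<in> Zn d \<and> vjoin n x (vjoin r y z) \<in> M"
    using rep sub by blast
  then obtain y z where yz: "\<And>x. x \<in> S \<Longrightarrow> y x \<in> Rn r \<and> z x \<in> Zn d \<and> vjoin n x (vjoin r (y x) (z x)) \<in> M"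
    by metis
  define par where "par x = {i\<in>{..<d}. even \<lfloor>z x i\<rfloor>}" for x
  have "finite (par ` R)"
    by (rule finite_subset[of _ "Pow {..<d}"]) (auto simp: par_def)
  then have "\<not> inj_on par R"
    using R(1) finite_imageD by blast
  then obtain u v where uv: "u \<in> R" "v \<in> R" "u \<noteq> v" "par u = par v"
    by (auto simp: inj_on_def)
  let ?mid = "\<lambda>f::(nat \<Rightarrow> real) \<Rightarrow> nat \<Rightarrow> real. (1/2) *\<^sub>R f u + (1/2) *\<^sub>R f v"
  have uS: "u \<in> S" "v \<in> S"
    using uv R by auto
  have 1: "?mid (\<lambda>x. vjoin n x (vjoin r (y x) (z x))) \<in> M"
    using yz[OF uS(1)] yz[OF uS(2)] M by (intro convexD) auto
  \<comment> \<open>Stacking is linear, so the averaged certificate splits into the averages of its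
    three blocks.\<close>
  have 2: "?mid (\<lambda>x. vjoin n x (vjoin r (y x) (z x))) = vjoin n (?mid (\<lambda>x. x)) (vjoin r (?mid y) (?mid z))"
    by (auto simp: vjoin_def scaleR_fun_def)
  have y: "?mid y \<in> Rn r"
    using yz[OF uS(1)] yz[OF uS(2)] by (auto simp: topspace_Euclidean_space scaleR_fun_def)
  have x: "?mid (\<lambda>x. x) \<in> Rn n"
    using subsetD[OF sub uS(1)] subsetD[OF sub uS(2)]
    by (auto simp: topspace_Euclidean_space scaleR_fun_def)
  have "?mid z i \<in> \<int>" if "i < d" for i
  proof -
    have "z u i \<in> \<int>" "z v i \<in> \<int>"
      using yz[OF uS(1)] yz[OF uS(2)] that by (auto simp: Zn_def)
    then obtain a b where ab: "z u i = of_int a" "z v i = of_int b"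
      by (auto elim!: Ints_cases)
    moreover have "i \<in> par u \<longleftrightarrow> i \<in> par v"
      using uv by simp
    ultimately have "even (a + b)"
      using that by (auto simp: par_def)
    then obtain c where "a + b = 2 * c" ..
    then have "real_of_int a + real_of_int b = 2 * real_of_int c"
      by linarith
    then have "?mid z i = of_int c"
      by (simp add: ab scaleR_fun_def)
    then show ?thesis
      by simp
  qed
  then have z: "?mid z \<in> Zn d"
    using yz[OF uS(1)] yz[OF uS(2)]
    by (auto simp: Zn_def topspace_Euclidean_space scaleR_fun_def)
  have "?mid (\<lambda>x. x) \<in> S"
    using rep[OF x] 1 2 y z by metis
  then show thesis
    using that uv by blast
qed

section \<open>Representability of closed convex sets and of minima of affine functions\<close>

lemma micpr_set_closed_convex:
  assumes "closedin (Euclidean_space n) X" "convex X"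
  shows "micpr_set n X"
proof -
  \<comment> \<open>Without auxiliary variables (\<open>r = d = 0\<close>) the stacked vector is
    \<open>x\<close> itself, so \<open>X\<close> can serve as its own \<open>M\<close>.\<close>
  have v: "vjoin n x (vjoin 0 y z) = x" if "x \<in> Rn n" "z \<in> Rn 0" for x y z
    using that by (auto simp: vjoin_def topspace_Euclidean_space)
  have "X \<subseteq> Rn n"
    using assms by (simp add: closedin_Euclidean_space_iff)
  moreover have "(\<lambda>_. 0) \<in> Rn 0" "(\<lambda>_. 0) \<in> Zn 0"
    by (auto simp: topspace_Euclidean_space Zn_def)
  ultimately show ?thesis
    unfolding micpr_set_def using assms v
    by (intro conjI exI[of _ 0] exI[of _ X]) (auto simp: Zn_def)
qed

lemma continuous_on_dot [continuous_intros]: "continuous_on X (dot n c)"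
  unfolding dot_def [abs_def]
  by (intro continuous_intros continuous_on_subset[OF continuous_on_product_coordinates]) auto

text \<open>Big-M formulation: an entry 1 of the integer vector \<open>z\<close> marks an active affine piece.\<close>

lemma micpr_fun_min_affine:
  fixes c :: "'i \<Rightarrow> nat \<Rightarrow> real" and e :: "'i \<Rightarrow> real"
  assumes X: "compactin (Euclidean_space n) X" "convex X" and J: "finite J"
    and f: "\<And>x t. x \<in> X \<Longrightarrow> f x \<le> t \<longleftrightarrow> (\<exists>j\<in>J. dot n (c j) x + e j \<le> t)"
  shows "micpr_fun n X f"
proof -
  have cX: "compact X" and XR: "X \<subseteq> Rn n"
    using X by (auto simp: compactin_Euclidean_space_iff)
  then have clX: "closed X"
    by (intro compact_imp_closed)
  define D where "D = card J"
  \<comment> \<open>The pieces are numbered so that coordinate \<open>i\<close> of the integer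
    vector can refer to the piece \<open>h i\<close>.\<close>
  obtain h where h: "bij_betw h {..<D} J"
    using ex_bij_betw_nat_finite[OF J] by (auto simp: D_def atLeast0LessThan)
  define l where "l i x = dot n (c (h i)) x + e (h i)" for i x
  have fl: "f x \<le> t \<longleftrightarrow> (\<exists>i<D. l i x \<le> t)" if "x \<in> X" for x t
    using f[OF that] h unfolding bij_betw_def l_def by (metis imageE imageI lessThan_iff)
  have "\<exists>B. \<forall>x\<in>X. \<bar>l i x\<bar> \<le> B" for i
  proof -
    have "compact (l i ` X)"
      unfolding l_def [abs_def] by (intro compact_continuous_image cX continuous_intros)
    then show ?thesis
      by (auto dest!: compact_imp_bounded simp: bounded_iff)
  qed
  then obtain B where B: "\<And>i x. x \<in> X \<Longrightarrow> \<bar>l i x\<bar> \<le> B i"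
    by metis
  \<comment> \<open>This is the big-M constant. It dominates the difference of any two pieces on
    \<open>X\<close>; the factor 2 accounts for one bound per piece.\<close>
  define C where "C = 2 * (\<Sum>i<D. \<bar>B i\<bar>)"
  have C: "l i x - l j x \<le> C" if "x \<in> X" "i < D" "j < D" for i j x
  proof -
    have "\<bar>B k\<bar> \<le> (\<Sum>i<D. \<bar>B i\<bar>)" if "k < D" for k
      using that by (intro member_le_sum) auto
    from this[OF that(2)] this[OF that(3)] B[OF that(1), of i] B[OF that(1), of j]
    show ?thesis by (simp add: C_def abs_le_iff)
  qed
  \<comment> \<open>Projection to the block of \<open>x\<close>, which removes the height and the
    certificate so that membership in \<open>X\<close> can be tested.\<close>
  define pr where "pr w = (\<lambda>i. if i < n then w i else 0)" for w :: "nat \<Rightarrow> real"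
  have cpr: "continuous_on UNIV pr"
    unfolding pr_def [abs_def]
  proof (rule continuous_on_coordinatewise_then_product)
    show "continuous_on UNIV (\<lambda>w. if i < n then w i else 0)" for i :: nat and w :: "nat \<Rightarrow> real"
      by (cases "i < n") (auto intro: continuous_on_product_coordinates)
  qed
  have dot_pr: "dot n u (pr w) = dot n u w" for u w
    by (simp add: dot_def pr_def)
  \<comment> \<open>Coordinates below \<open>n\<close> hold the point, coordinate \<open>n\<close>
    the height \<open>t\<close>, and coordinate \<open>n + 1 + i\<close> the integer variable of
    piece \<open>i\<close>. There are no continuous auxiliary variables, hence the summand
    0.\<close>
  define M where "M = Rn (n + 1 + 0 + D) \<inter> {w. pr w \<in> X} \<inter> {w. 1 \<le> (\<Sum>i<D. w (n + 1 + i))} \<inter>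
    (\<Inter>i\<in>{..<D}. {w. w (n + 1 + i) \<le> 1} \<inter> {w. l i w - C * (1 - w (n + 1 + i)) \<le> w n})"
  have clM: "closedin (Euclidean_space (n + 1 + 0 + D)) M"
  proof -
    have "closed (Rn (n + 1 + 0 + D))"
      using closedin_Euclidean_space_iff closedin_topspace by blast
    moreover have "closed {w. pr w \<in> X}"
      using continuous_closed_vimage[OF clX, of pr] cpr
      by (simp add: vimage_def continuous_on_eq_continuous_within)
    moreover have "closed {w. 1 \<le> (\<Sum>i<D. w (n + 1 + i) :: real)}"
      by (intro closed_Collect_le continuous_intros continuous_on_product_coordinates)
    moreover have "closed {w. w (n + 1 + i) \<le> (1::real)}" for i
      by (intro closed_Collect_le continuous_intros continuous_on_product_coordinates)
    moreover have "closed {w. l i w - C * (1 - w (n + 1 + i)) \<le> w n}" for i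
      unfolding l_def
      by (intro closed_Collect_le continuous_intros continuous_on_product_coordinates)
    ultimately have "closed M"
      unfolding M_def by (intro closed_Int closed_INT ballI)
    then show ?thesis
      by (auto simp: closedin_Euclidean_space_iff M_def)
  qed
  have "convex M"
  proof (rule convexI)
    fix v w :: "nat \<Rightarrow> real" and s t :: real
    assume vM: "v \<in> M" and wM: "w \<in> M" and st: "0 \<le> s" "0 \<le> t" "s + t = 1"
    let ?u = "s *\<^sub>R v + t *\<^sub>R w"
    have u: "?u i = s * v i + t * w i" for i
      by (simp add: scaleR_fun_def)
    have t: "t = 1 - s" using st by simp
    have 1: "?u \<in> Rn (n + 1 + 0 + D)"
      using vM wM unfolding M_def topspace_Euclidean_space by (simp add: scaleR_fun_def)
    have "pr ?u = s *\<^sub>R pr v + t *\<^sub>R pr w"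
      by (auto simp: pr_def scaleR_fun_def)
    then have 2: "pr ?u \<in> X"
      using vM wM st X(2) by (simp add: M_def convexD)
    have sum: "(\<Sum>i<D. ?u (n + 1 + i)) = s * (\<Sum>i<D. v (n + 1 + i)) + t * (\<Sum>i<D. w (n + 1 + i))"
      by (simp only: u sum.distrib sum_distrib_left)
    have "s * 1 + t * 1 \<le> s * (\<Sum>i<D. v (n + 1 + i)) + t * (\<Sum>i<D. w (n + 1 + i))"
      using vM wM st by (intro add_mono mult_left_mono) (auto simp: M_def)
    then have 3: "1 \<le> (\<Sum>i<D. ?u (n + 1 + i))"
      using st by (simp only: sum)
    have 4: "?u (n + 1 + i) \<le> 1 \<and> l i ?u - C * (1 - ?u (n + 1 + i)) \<le> ?u n" if "i < D" for i
    proof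
      have "s * v (n + 1 + i) + t * w (n + 1 + i) \<le> s * 1 + t * 1"
        using vM wM st that by (intro add_mono mult_left_mono) (auto simp: M_def)
      then show "?u (n + 1 + i) \<le> 1"
        using st by (simp only: u)
      have dot: "dot n (c (h i)) ?u = s * dot n (c (h i)) v + t * dot n (c (h i)) w"
        by (simp only: dot_def u sum_distrib_left sum.distrib [symmetric]) (simp add: algebra_simps)
      \<comment> \<open>The constants \<open>e'\<close> and \<open>C\<close> are distributed with
        the weights \<open>s\<close> and \<open>t\<close>, which sum to 1.\<close>
      have "s * L + t * L' + e' - C * (1 - (s * V + t * W)) =
          s * (L + e' - C * (1 - V)) + t * (L' + e' - C * (1 - W))" for L L' V W e'
        by (simp add: t algebra_simps)
      then have "l i ?u - C * (1 - ?u (n + 1 + i)) =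
          s * (l i v - C * (1 - v (n + 1 + i))) + t * (l i w - C * (1 - w (n + 1 + i)))"
        by (simp only: l_def u dot)
      also have "\<dots> \<le> s * v n + t * w n"
        using vM wM st that by (intro add_mono mult_left_mono) (auto simp: M_def)
      finally show "l i ?u - C * (1 - ?u (n + 1 + i)) \<le> ?u n"
        by (simp only: u)
    qed
    show "?u \<in> M"
      unfolding M_def using 1 2 3 4 by blast
  qed
  have l_pr: "l i (pr w) = l i w" for i w
    by (simp add: l_def dot_pr)
  let ?E = "(\<lambda>(x, t). x(n := t)) ` epigraph X f"
  \<comment> \<open>The epigraph in the coordinates used by \<open>M\<close>: the point is
    \<open>pr w\<close> and the height is \<open>w n\<close>.\<close>
  have E: "w \<in> ?E \<longleftrightarrow> pr w \<in> X \<and> (\<exists>i<D. l i w \<le> w n)" if w: "w \<in> Rn (n + 1)" for w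
  proof
    assume "w \<in> ?E"
    then obtain x t where xt: "x \<in> X" "f x \<le> t" "w = x(n := t)"
      by (auto simp: epigraph_def)
    then have "pr w = x"
      using XR by (auto simp: pr_def topspace_Euclidean_space fun_eq_iff)
    with xt fl[OF xt(1)] show "pr w \<in> X \<and> (\<exists>i<D. l i w \<le> w n)"
      by (metis fun_upd_same l_pr)
  next
    assume *: "pr w \<in> X \<and> (\<exists>i<D. l i w \<le> w n)"
    then have "(pr w, w n) \<in> epigraph X f"
      using fl by (auto simp: epigraph_def l_pr)
    moreover have "w = (pr w)(n := w n)"
      using w by (auto simp: pr_def topspace_Euclidean_space fun_eq_iff)
    ultimately show "w \<in> ?E"
      by (metis (mono_tags, lifting) case_prod_conv image_eqI)
  qed
  have "?E \<subseteq> Rn (n + 1)"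
    using XR by (auto simp: epigraph_def topspace_Euclidean_space)
  moreover have "w \<in> ?E \<longleftrightarrow> (\<exists>y\<in>Rn 0. \<exists>z\<in>Zn D. vjoin (n + 1) w (vjoin 0 y z) \<in> M)"
    if w: "w \<in> Rn (n + 1)" for w
  proof -
    let ?v = "\<lambda>y z. vjoin (n + 1) w (vjoin 0 y z)"
    have vn: "?v y z n = w n" and vi: "?v y z (n + 1 + i) = z i" for y z i
      by (simp_all add: vjoin_def)
    have lv: "l i (?v y z) = l i w" for i y z
      by (simp add: l_def dot_def vjoin_def)
    have prv: "pr (?v y z) = pr w" for y z
      by (auto simp: pr_def vjoin_def)
    have Rv: "?v y z \<in> Rn (n + 1 + 0 + D)" if "z \<in> Zn D" for y z
      using that by (auto simp: Zn_def topspace_Euclidean_space vjoin_def)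
    have M: "?v y z \<in> M \<longleftrightarrow> pr w \<in> X \<and> 1 \<le> (\<Sum>i<D. z i) \<and>
        (\<forall>i<D. z i \<le> 1 \<and> l i w - C * (1 - z i) \<le> w n)" if "z \<in> Zn D" for y z
      unfolding M_def Int_iff mem_Collect_eq INT_iff lv prv vn vi
      using Rv[OF that] by blast
    show ?thesis
    proof
      assume "w \<in> ?E"
      with E[OF w] obtain j where j: "pr w \<in> X" "j < D" "l j w \<le> w n"
        by blast
      \<comment> \<open>Only piece \<open>j\<close> is switched on. For every other piece,
        \<open>C\<close> covers the gap between \<open>l i w\<close> and \<open>l j w\<close>, which
        is at most \<open>w n\<close>.\<close>
      define z :: "nat \<Rightarrow> real" where "z i = (if i = j then 1 else 0)" for i
      have z: "z \<in> Zn D"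
        using j by (auto simp: Zn_def z_def topspace_Euclidean_space)
      have "l i w - C * (1 - z i) \<le> w n" if "i < D" for i
        using C[OF j(1) that j(2)] j(3) by (auto simp: z_def l_pr)
      then have "vjoin (n + 1) w (vjoin 0 (\<lambda>_. 0) z) \<in> M"
        unfolding M[OF z] using j by (auto simp: z_def)
      moreover have "(\<lambda>_. 0) \<in> Rn 0"
        by (simp add: topspace_Euclidean_space)
      ultimately show "\<exists>y\<in>Rn 0. \<exists>z\<in>Zn D. vjoin (n + 1) w (vjoin 0 y z) \<in> M"
        using z by blast
    next
      assume "\<exists>y\<in>Rn 0. \<exists>z\<in>Zn D. vjoin (n + 1) w (vjoin 0 y z) \<in> M"
      then obtain z where z: "z \<in> Zn D" "pr w \<in> X" "1 \<le> (\<Sum>i<D. z i)"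
        "\<And>i. i < D \<Longrightarrow> z i \<le> 1 \<and> l i w - C * (1 - z i) \<le> w n"
        using M by blast
      \<comment> \<open>Entries may be negative, but a sum of at least 1 forces a positive one.
        Integrality and the upper bound make it equal to 1, where the big-M term vanishes.\<close>
      have "\<exists>i<D. 0 < z i"
      proof (rule ccontr)
        assume "\<not> (\<exists>i<D. 0 < z i)"
        then have "(\<Sum>i<D. z i) \<le> 0"
          by (intro sum_nonpos) (meson lessThan_iff not_less)
        with z(3) show False by simp
      qed
      then obtain i where i: "i < D" "0 < z i" by blast
      moreover from z(1) i obtain k where "z i = of_int k"
        by (auto simp: Zn_def elim: Ints_cases)
      ultimately have "z i = 1"
        using z(4)[OF i(1)] by auto
      with z(4)[OF i(1)] have "l i w \<le> w n" by simp
      with E[OF w] z(2) i(1) show "w \<in> ?E" by blast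
    qed
  qed
  ultimately have "micpr_set (n + 1) ?E"
    unfolding micpr_set_def using clM \<open>convex M\<close>
    by (intro conjI exI[of _ 0] exI[of _ D] exI[of _ M]) simp_all
  moreover have "micpr_set n X"
    using clX XR X(2) by (intro micpr_set_closed_convex) (auto simp: closedin_Euclidean_space_iff)
  ultimately show ?thesis
    by (simp add: micpr_fun_def)
qed

section \<open>The case \<open>p = \<infinity>\<close>\<close>

lemma lp_norm_1: "lp_norm N 1 v = (\<Sum>i<N. \<bar>v i\<bar>)"
  by (simp add: lp_norm_def sum_nonneg)

lemma conj_exponent_top: "conj_exponent \<infinity> = 1"
  by (simp add: conj_exponent_def)

text \<open>Exchanging the two sums moves the matrix to the other factor, which exposes the
  coefficients of an affine function of \<open>x\<close>.\<close>

lemma dot_affine_vec: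
  "dot m u (affine_vec n m A a x) = dot n (\<lambda>j. \<Sum>i<m. u i * A i j) x + dot m u a"
proof -
  have "(\<Sum>i<m. u i * (\<Sum>j<n. A i j * x j)) = (\<Sum>j<n. (\<Sum>i<m. u i * A i j) * x j)"
    unfolding sum_distrib_left sum_distrib_right
    by (subst sum.swap) (simp add: mult.assoc)
  then show ?thesis
    by (simp add: dot_def affine_vec_def distrib_left sum.distrib)
qed

lemma dfo_objective_le_iff:
  assumes "1 \<le> K"
  shows "dfo_objective n m K p \<xi> \<theta> A a B b x \<le> t \<longleftrightarrow>
    (\<exists>k\<in>{1..K}. dot m \<xi> (affine_vec n m (A k) (a k) x) + (dot n (B k) x + b k)
              - \<theta> * lp_norm m (conj_exponent p) (affine_vec n m (A k) (a k) x) \<le> t)"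
  using assms unfolding dfo_objective_def by (subst Min_le_iff) auto

text \<open>The 1-norm is the largest product of \<open>v\<close> with a sign vector. It enters with
  the factor \<open>- \<theta> \<le> 0\<close>, so the maximum turns into a minimum, and a bound on
  a minimum is an existential statement.\<close>

lemma sum_abs_le_iff_signs:
  fixes v :: "nat \<Rightarrow> real"
  assumes "0 \<le> \<theta>"
  shows "s - \<theta> * (\<Sum>i<m. \<bar>v i\<bar>) \<le> t \<longleftrightarrow>
    (\<exists>I\<in>Pow {..<m}. s - \<theta> * dot m (\<lambda>i. if i \<in> I then 1 else -1) v \<le> t)"
    (is "?L \<longleftrightarrow> ?R")
proof
  assume ?L
  \<comment> \<open>The maximizing sign vector is +1 exactly on the nonnegative entries.\<close>
  moreover have "dot m (\<lambda>i. if i \<in> {i\<in>{..<m}. 0 \<le> v i} then 1 else -1) v = (\<Sum>i<m. \<bar>v i\<bar>)"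
    unfolding dot_def by (intro sum.cong) auto
  ultimately show ?R
    by (intro bexI[of _ "{i\<in>{..<m}. 0 \<le> v i}"]) auto
next
  assume ?R
  then obtain I where I: "s - \<theta> * dot m (\<lambda>i. if i \<in> I then 1 else -1) v \<le> t"
    by blast
  have "dot m (\<lambda>i. if i \<in> I then 1 else -1) v \<le> (\<Sum>i<m. \<bar>v i\<bar>)"
    unfolding dot_def by (intro sum_mono) auto
  then have "\<theta> * dot m (\<lambda>i. if i \<in> I then 1 else -1) v \<le> \<theta> * (\<Sum>i<m. \<bar>v i\<bar>)"
    using assms by (rule mult_left_mono)
  with I show ?L by linarith
qed

lemma dot_add_left: "dot n (\<lambda>i. u i + v i) x = dot n u x + dot n v x"
  by (simp add: dot_def distrib_right sum.distrib)

lemma micpr_fun_dfo_objective_top: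
  assumes "dfo_data n m K X \<xi> \<theta>"
  shows "micpr_fun n X (dfo_objective n m K \<infinity> \<xi> \<theta> A a B b)"
proof -
  \<comment> \<open>In the first \<open>m\<close> coordinates the vectors \<open>?s I\<close> are
    the corners of the box of radius \<theta> around \<xi>, the ball of the \<infinity>-norm. Each
    pair \<open>(k, I)\<close> contributes one affine piece.\<close>
  let ?s = "\<lambda>I i. \<xi> i - \<theta> * (if i \<in> I then 1 else -1)"
  have X: "1 \<le> K" "0 \<le> \<theta>" "compactin (Euclidean_space n) X" "convex X"
    using assms by (auto simp: dfo_data_def)
  have s: "dot m (?s I) v = dot m \<xi> v - \<theta> * dot m (\<lambda>i. if i \<in> I then 1 else -1) v" for I v
    by (simp add: dot_def sum_distrib_left sum_subtractf left_diff_distrib mult.assoc)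
  show ?thesis
  proof (rule micpr_fun_min_affine[OF X(3,4), where J = "{1..K} \<times> Pow {..<m}" and
      c = "\<lambda>(k, I) j. (\<Sum>i<m. ?s I i * A k i j) + B k j" and e = "\<lambda>(k, I). dot m (?s I) (a k) + b k"])
    show "dfo_objective n m K \<infinity> \<xi> \<theta> A a B b x \<le> t \<longleftrightarrow>
      (\<exists>j\<in>{1..K} \<times> Pow {..<m}.
        dot n (case j of (k, I) \<Rightarrow> \<lambda>j. (\<Sum>i<m. ?s I i * A k i j) + B k j) x
        + (case j of (k, I) \<Rightarrow> dot m (?s I) (a k) + b k) \<le> t)" for x t
    proof -
      have "dot n (\<lambda>j. (\<Sum>i<m. ?s I i * A k i j) + B k j) x + (dot m (?s I) (a k) + b k) =
        dot m \<xi> (affine_vec n m (A k) (a k) x) + (dot n (B k) x + b k)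
        - \<theta> * dot m (\<lambda>i. if i \<in> I then 1 else -1) (affine_vec n m (A k) (a k) x)" for k I
        using dot_affine_vec[of m "?s I" n "A k" "a k" x] by (simp only: s dot_add_left)
      then show ?thesis
        unfolding dfo_objective_le_iff[OF X(1)] conj_exponent_top lp_norm_1
          sum_abs_le_iff_signs[OF X(2)] by (simp only: bex_simps split_paired_Bex_Sigma prod.case)
    qed
  qed auto
qed

section \<open>The case \<open>1 < p < \<infinity>\<close>\<close>

text \<open>Here \<open>g t\<close> is the \<open>q\<close>-norm of the vector (t, 1). Its
  derivative is strictly increasing for positive arguments, and the mean value theorem on the two
  halves of the interval compares the slopes.\<close>

lemma powr_norm_midpoint_less:
  fixes q x y :: real
  assumes q: "1 < q" and x: "0 < x" "x < y"
  defines "g \<equiv> \<lambda>x. (x powr q + 1) powr (1 / q)"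
  shows "g ((x + y) / 2) < (g x + g y) / 2"
proof -
  \<comment> \<open>The derivative is written as a positive power of
    \<open>t powr q / (t powr q + 1)\<close>, a form in which monotonicity is visible.\<close>
  define g' where "g' t = (t powr q / (t powr q + 1)) powr ((q - 1) / q)" for t :: real
  have der: "(g has_real_derivative g' t) (at t)" if "0 < t" for t
  proof -
    have pos: "0 < t powr q + 1"
      by (simp add: add_nonneg_pos)
    have "(g has_real_derivative (1 / q) * (t powr q + 1) powr (1 / q - 1) * (q * t powr (q - 1))) (at t)"
      unfolding g_def using that q pos by (auto intro!: derivative_eq_intros)
    also have "(1 / q) * (t powr q + 1) powr (1 / q - 1) * (q * t powr (q - 1)) = g' t"
    proof -
      have "t powr (q - 1) = (t powr q) powr ((q - 1) / q)"
        using q by (simp add: powr_powr)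
      moreover have "1 / q - 1 = - ((q - 1) / q)"
        using q by (simp add: field_simps)
      ultimately show ?thesis
        using q pos by (simp add: g'_def powr_divide powr_minus_divide)
    qed
    finally show ?thesis .
  qed
  have mono: "g' s < g' t" if "0 < s" "s < t" for s t
  proof -
    have "s powr q < t powr q"
      using that q by (simp add: powr_less_mono2)
    then have "s powr q / (s powr q + 1) < t powr q / (t powr q + 1)"
      using add_nonneg_pos[of "s powr q" 1] add_nonneg_pos[of "t powr q" 1]
      by (simp add: divide_simps) (simp add: algebra_simps)
    then show ?thesis
      unfolding g'_def using q by (intro powr_less_mono2) auto
  qed
  let ?m = "(x + y) / 2"
  obtain u where u: "x < u" "u < ?m" "g ?m - g x = (?m - x) * g' u"
    using MVT2[of x ?m g g'] x der by force
  obtain v where v: "?m < v" "v < y" "g y - g ?m = (y - ?m) * g' v"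
    using MVT2[of ?m y g g'] x der by force
  have "(y - x) / 2 * g' u < (y - x) / 2 * g' v"
    using mono[of u v] x u v by (intro mult_strict_left_mono) auto
  moreover have "?m - x = (y - x) / 2" "y - ?m = (y - x) / 2"
    by (auto simp: field_simps)
  ultimately show ?thesis
    using u v by argo
qed

text \<open>The graph of \<open>f\<close> over \<open>Y\<close> is an infinite subset of the
  epigraph, so two of its points have their midpoint in the epigraph. The height coordinate of that
  midpoint gives the inequality.\<close>

lemma micpr_fun_midpoint:
  assumes f: "micpr_fun n X f" and Y: "infinite Y" "Y \<subseteq> X" and X: "X \<subseteq> Rn n"
  obtains x y where "x \<in> Y" "y \<in> Y" "x \<noteq> y" "f ((1/2) *\<^sub>R x + (1/2) *\<^sub>R y) \<le> (f x + f y) / 2"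
proof -
  let ?G = "\<lambda>x. x(n := f x)"
  let ?E = "(\<lambda>(x, t). x(n := t)) ` epigraph X f"
  \<comment> \<open>Points of \<open>Rn n\<close> are 0 at index \<open>n\<close>, so resetting that
    coordinate undoes the insertion of the height.\<close>
  have E: "w(n := 0) \<in> X \<and> f (w(n := 0)) \<le> w n" if "w \<in> ?E" for w
  proof -
    from that obtain x t where xt: "x \<in> X" "f x \<le> t" "w = x(n := t)"
      by (auto simp: epigraph_def)
    moreover have "w(n := 0) = x"
      using subsetD[OF X xt(1)] xt(3) by (auto simp: topspace_Euclidean_space)
    ultimately show ?thesis
      by simp
  qed
  have G0: "(?G x)(n := 0) = x" if "x \<in> X" for x
    using subsetD[OF X that] by (auto simp: topspace_Euclidean_space)
  then have "inj_on ?G Y"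
    using Y(2) by (intro inj_on_inverseI[where g = "\<lambda>w. w(n := 0)"]) blast
  then have "infinite (?G ` Y)"
    using Y(1) by (simp add: finite_image_iff)
  moreover have "?G ` Y \<subseteq> ?E"
    using Y(2) by (force simp: epigraph_def)
  moreover have "micpr_set (n + 1) ?E"
    using f by (simp add: micpr_fun_def)
  ultimately obtain u v where uv: "u \<in> ?G ` Y" "v \<in> ?G ` Y" "u \<noteq> v" "(1/2) *\<^sub>R u + (1/2) *\<^sub>R v \<in> ?E"
    using micpr_set_midpoint by blast
  then obtain x y where xy: "x \<in> Y" "y \<in> Y" "x \<noteq> y" "u = ?G x" "v = ?G y"
    by blast
  let ?w = "(1/2) *\<^sub>R u + (1/2) *\<^sub>R v"
  have "?w(n := 0) = (1/2) *\<^sub>R (u(n := 0)) + (1/2) *\<^sub>R (v(n := 0))"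
    by (auto simp: scaleR_fun_def)
  also have "\<dots> = (1/2) *\<^sub>R x + (1/2) *\<^sub>R y"
    using xy(4,5) G0[OF subsetD[OF Y(2) xy(1)]] G0[OF subsetD[OF Y(2) xy(2)]] by simp
  finally have "f ((1/2) *\<^sub>R x + (1/2) *\<^sub>R y) \<le> ?w n"
    using E[OF uv(4)] by simp
  also have "?w n = (f x + f y) / 2"
    by (simp add: xy scaleR_fun_def)
  finally show thesis
    using that xy by blast
qed

lemma infinite_Icc_vec: "infinite {x \<in> Rn 1. x 0 \<in> {1..2}}"
proof
  assume "finite {x \<in> Rn 1. x 0 \<in> {1..2}}"
  then have "finite ((\<lambda>x. x 0) ` {x \<in> Rn 1. x 0 \<in> {1..2}})"
    by simp
  moreover have "{1..2} \<subseteq> (\<lambda>x. x 0) ` {x \<in> Rn 1. x 0 \<in> {1..2::real}}"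
  proof
    fix t :: real
    assume "t \<in> {1..2}"
    then show "t \<in> (\<lambda>x. x 0) ` {x \<in> Rn 1. x 0 \<in> {1..2}}"
      by (intro image_eqI[of _ _ "\<lambda>i. if i = 0 then t else 0"]) (auto simp: topspace_Euclidean_space)
  qed
  ultimately have "finite {1..2::real}"
    by (rule finite_subset[rotated])
  then show False
    using infinite_Icc[of 1 "2::real"] by simp
qed

lemma dfo_data_Icc_vec:
  "dfo_data 1 m 1 {x \<in> Rn 1. x 0 \<in> {1..2}} (\<lambda>_. 0) 1"
proof -
  let ?X = "{x \<in> Rn 1. x 0 \<in> {1..2::real}}"
  let ?v = "\<lambda>t i. if i = (0::nat) then t else (0::real)"
  have eq: "?X = ?v ` {1..2}"
    by (auto simp: topspace_Euclidean_space image_iff fun_eq_iff)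
  have "continuous_on {1..2} ?v"
  proof (rule continuous_on_coordinatewise_then_product)
    show "continuous_on {1..2} (\<lambda>t. ?v t i)" for i
      by (cases "i = 0") (auto intro: continuous_intros)
  qed
  then have "compact ?X"
    unfolding eq by (intro compact_continuous_image) auto
  moreover have "convex ?X"
  proof (rule convexI)
    fix x y :: "nat \<Rightarrow> real" and s t :: real
    assume xy: "x \<in> ?X" "y \<in> ?X" and st: "0 \<le> s" "0 \<le> t" "s + t = 1"
    have "s * 1 + t * 1 \<le> s * x 0 + t * y 0" "s * x 0 + t * y 0 \<le> s * 2 + t * 2"
      using xy st by (intro add_mono mult_left_mono; simp)+
    then show "s *\<^sub>R x + t *\<^sub>R y \<in> ?X"
      using xy st by (auto simp: scaleR_fun_def topspace_Euclidean_space)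
  qed
  moreover have "rel_interior ?X \<noteq> {}"
  proof -
    have "affine (Rn 1)"
      by (auto simp: affine_def topspace_Euclidean_space scaleR_fun_def)
    then have hull: "affine hull ?X \<subseteq> Rn 1"
      by (intro hull_minimal) auto
    \<comment> \<open>An open slab of the whole function space. Inside \<open>Rn 1\<close>, which
      contains the affine hull, it cuts out only points of the interval, and 3/2 lies in it.\<close>
    let ?U = "{x. (1::real) < x (0::nat)} \<inter> {x. x 0 < 2}"
    have "open ?U"
      by (intro open_Int open_Collect_less continuous_on_product_coordinates continuous_on_const)
    moreover have "?v (3/2) \<in> ?X"
      by (auto simp: topspace_Euclidean_space)
    ultimately have "openin (top_of_set (affine hull ?X)) (affine hull ?X \<inter> ?U)"
        "?v (3/2) \<in> affine hull ?X \<inter> ?U"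
      by (auto intro: openin_open_Int hull_inc)
    moreover have "affine hull ?X \<inter> ?U \<subseteq> ?X"
      using hull by auto
    ultimately have "?v (3/2) \<in> rel_interior ?X"
      unfolding rel_interior_def by blast
    then show ?thesis
      by blast
  qed
  moreover have "(\<lambda>_. 0) \<in> Rn m"
    by (simp add: topspace_Euclidean_space)
  ultimately show ?thesis
    by (auto simp: dfo_data_def compactin_Euclidean_space_iff)
qed

lemma not_micpr_fun_dfo_objective:
  assumes "1 < p" "p < \<infinity>"
  shows "\<exists>n m K X \<xi> \<theta> A a B b. dfo_data n m K X \<xi> \<theta> \<and>
    \<not> micpr_fun n X (dfo_objective n m K p \<xi> \<theta> A a B b)"
proof -
  let ?X = "{x \<in> Rn 1. x 0 \<in> {1..2}}"
  \<comment> \<open>The single affine map sends \<open>x\<close> to (x, 1), with \<xi>,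
    \<open>B\<close> and \<open>b\<close> zero and \<open>\<theta> = 1\<close>. The constant second
    entry is essential to the strict curvature: along a ray from the origin a norm is
    linear.\<close>
  let ?f = "dfo_objective 1 2 1 p (\<lambda>_. 0) 1 (\<lambda>k i j. if i = 0 then 1 else 0)
    (\<lambda>k i. if i = 0 then 0 else 1) (\<lambda>k j. 0) (\<lambda>k. 0)"
  obtain r where r: "p = ennreal r" "1 < r"
    using assms by (cases p) (auto simp: ennreal_less_iff simp flip: ennreal_1)
  define q where "q = r / (r - 1)"
  have q: "1 < q"
    using r by (simp add: q_def field_simps)
  define g where "g t = (t powr q + 1) powr (1 / q)" for t :: real
  have f: "?f x = - g (x 0)" if "0 \<le> x 0" for x
    using that q unfolding dfo_objective_def r(1) conj_exponent_ennreal[OF r(2)]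
    by (simp add: lp_norm_def affine_vec_def dot_def g_def numeral_2_eq_2 flip: q_def)
  have "\<not> micpr_fun 1 ?X ?f"
  proof
    assume "micpr_fun 1 ?X ?f"
    then obtain x y where xy: "x \<in> ?X" "y \<in> ?X" "x \<noteq> y"
      and le: "?f ((1/2) *\<^sub>R x + (1/2) *\<^sub>R y) \<le> (?f x + ?f y) / 2"
      by (rule micpr_fun_midpoint[OF _ infinite_Icc_vec]) auto
    have "?f ((1/2) *\<^sub>R x + (1/2) *\<^sub>R y) = - g ((x 0 + y 0) / 2)"
      using xy by (subst f) (auto simp: scaleR_fun_def add_divide_distrib)
    moreover have "0 \<le> x 0" "0 \<le> y 0"
      using xy by auto
    ultimately have "(g (x 0) + g (y 0)) / 2 \<le> g ((x 0 + y 0) / 2)"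
      using le f[of x] f[of y] by simp
    moreover have "x 0 \<noteq> y 0"
    proof
      assume "x 0 = y 0"
      then have "x i = y i" for i
        using xy by (cases i) (auto simp: topspace_Euclidean_space)
      with xy show False by blast
    qed
    moreover have "g ((s + t) / 2) < (g s + g t) / 2" if "0 < s" "s < t" for s t
      unfolding g_def by (rule powr_norm_midpoint_less[OF q that])
    ultimately show False
      using xy by (smt (verit, best) add.commute atLeastAtMost_iff mem_Collect_eq)
  qed
  then show ?thesis
    using dfo_data_Icc_vec by blast
qed

theorem theorem2:
  shows "(\<forall>n m K X \<xi> \<theta> A a B b.
            dfo_data n m K X \<xi> \<theta> \<longrightarrow>
            micpr_fun n X (dfo_objective n m K \<infinity> \<xi> \<theta> A a B b)) \<and>
         (\<forall>p::ennreal. 1 < p \<and> p < \<infinity> \<longrightarrow>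
            (\<exists>n m K X \<xi> \<theta> A a B b.
               dfo_data n m K X \<xi> \<theta> \<and>
               \<not> micpr_fun n X (dfo_objective n m K p \<xi> \<theta> A a B b)))"
  by (intro conjI allI impI micpr_fun_dfo_objective_top not_micpr_fun_dfo_objective) auto

end
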